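(* Let $D\subseteq\mathbb{R}^d$ be open and $f:D\to\mathbb{R}^d$ locally Lipschitz. Let $x^*\in D$ be an equilibrium of $\dot x=f(x)$ that is asymptotically stable on a compact set $S\subseteq D$ with $x^*\in\mathrm{int}(S)$. Let $\|\cdot\|$ be any norm on $\mathbb{R}^d$. Then for any $\varepsilon>0$ such that $B_\varepsilon(x^* )\subset\mathrm{int}(S)$, there exists a finite $\tau>0$ such that the function $V(x):=\|x-x^*\|$ is an $\varepsilon$-Strict Recurrent Lyapunov Function ($\varepsilon$-SRLF) over $S$ with parameter $\tau$.
   Context: Locally Lipschitz means: for every compact $K\subset D$ there is $\overline L_K\ge 0$ with $\|f(y)-f(x)\|\le \overline L_K\|y-x\|$ for all $x,y\in K$. For $x\in D$, $\phi(t,x)$ is the solution of $\dot x=f(x)$ with $\phi(0,x)=x$, on its maximal open interval of existence $I(x)\ni 0$. Assertions about $\phi(t,x)$ for all $t\ge0$ (or $t\to\infty$) include existence of the solution for all $t\ge0$. $B_r(x)$ is the closed $\|\cdot\|$-ball of radius $r$ centered at $x$. Asymptotically stable on $S$ (with $x^*\in\mathrm{int}(S)$): (a) for every $\varepsilon>0$ there is $\delta>0$ such that $\|x-x^*\|\le\delta$ implies $\|\phi(t,x)-x^*\|\le\varepsilon$ for all $t\ge0$; and (b) for every $x\in S$, $\|\phi(t,x)-x^*\|\to0$ as $t\to\infty$. Containment times: $T_S(x;\tau):=\{t\in(0,\tau]: \phi(t,x)\in S\}$ (with $t\in I(x)$). An inequality $\min_{s\in T_S(x;\tau)}g(s)<c$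 means that there is $s\in T_S(x;\tau)$ with $g(s)<c$. $\varepsilon$-SRLF: given $\varepsilon>0$ with $B_\varepsilon(x^* )\subset\mathrm{int}(S)$ and $\tau>0$, a continuous $V:D\to\mathbb{R}_{\ge0}$ is an $\varepsilon$-SRLF over $S$ with parameter $\tau$ if (i) $V(x^* )=0$ and $V(x)>0$ for all $x\in D\setminus\{x^*\}$; (ii) $\min_{s\in T_S(x;\tau)}V(\phi(s,x))<V(x)$ for all $x\in K_\varepsilon:=\mathrm{cl}(S\setminus B_\varepsilon(x^* ))$. *)

theory Defs
  imports "HOL-Analysis.Analysis"
begin

text \<open>An arbitrary norm on a real vector space, as opposed to the fixed Euclidean
  \<^const>\<open>norm\<close>. Topological notions (open, compact, interior, closure, continuity) refer to the
  standard topology of \<open>\<real>\<^sup>d\<close>, which every norm induces.\<close>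

definition is_norm :: "('a::real_vector \<Rightarrow> real) \<Rightarrow> bool" where
  "is_norm N \<longleftrightarrow>
     (\<forall>x. 0 \<le> N x) \<and>
     (\<forall>x. N x = 0 \<longleftrightarrow> x = 0) \<and>
     (\<forall>c x. N (c *\<^sub>R x) = \<bar>c\<bar> * N x) \<and>
     (\<forall>x y. N (x + y) \<le> N x + N y)"

definition nball :: "('a::real_vector \<Rightarrow> real) \<Rightarrow> 'a \<Rightarrow> real \<Rightarrow> 'a set" where
  "nball N c r = {y. N (y - c) \<le> r}"

definition locally_lipschitz ::
  "(real^'n \<Rightarrow> real) \<Rightarrow> (real^'n) set \<Rightarrow> (real^'n \<Rightarrow> real^'n) \<Rightarrow> bool" where
  "locally_lipschitz N D f \<longleftrightarrow>
     (\<forall>K. compact K \<and> K \<subseteq> D \<longrightarrow>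
        (\<exists>L\<ge>0. \<forall>x\<in>K. \<forall>y\<in>K. N (f y - f x) \<le> L * N (y - x)))"

definition solution_on ::
  "(real^'n \<Rightarrow> real^'n) \<Rightarrow> (real^'n) set \<Rightarrow> real^'n \<Rightarrow> real set \<Rightarrow> (real \<Rightarrow> real^'n) \<Rightarrow> bool" where
  "solution_on f D x J u \<longleftrightarrow>
     open J \<and> is_interval J \<and> 0 \<in> J \<and> u 0 = x \<and>
     (\<forall>t\<in>J. u t \<in> D \<and> (u has_vector_derivative f (u t)) (at t))"

text \<open>For locally Lipschitz \<open>f\<close> any two solutions with the same initial value agree on the
  intersection of their intervals. Hence the union below is the maximal open interval of existence
  and the value selected by \<open>flow\<close> is, at every time in that interval, well defined.\<close>

definition ex_ivl :: "(real^'n \<Rightarrow> real^'n) \<Rightarrow> (real^'n) set \<Rightarrow> real^'n \<Rightarrow> real set" where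
  "ex_ivl f D x = \<Union>{J. \<exists>u. solution_on f D x J u}"

definition flow :: "(real^'n \<Rightarrow> real^'n) \<Rightarrow> (real^'n) set \<Rightarrow> real \<Rightarrow> real^'n \<Rightarrow> real^'n" where
  "flow f D t x = (THE y. \<exists>J u. solution_on f D x J u \<and> t \<in> J \<and> u t = y)"

definition equilibrium :: "(real^'n \<Rightarrow> real^'n) \<Rightarrow> (real^'n) set \<Rightarrow> real^'n \<Rightarrow> bool" where
  "equilibrium f D xs \<longleftrightarrow> xs \<in> D \<and> f xs = 0"

definition asymptotically_stable_on ::
  "(real^'n \<Rightarrow> real) \<Rightarrow> (real^'n \<Rightarrow> real^'n) \<Rightarrow> (real^'n) set \<Rightarrow> real^'n \<Rightarrow> (real^'n) set \<Rightarrow> bool" where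
  "asymptotically_stable_on N f D xs S \<longleftrightarrow>
     xs \<in> interior S \<and>
     (\<forall>\<epsilon>>0. \<exists>\<delta>>0. \<forall>x\<in>D. N (x - xs) \<le> \<delta> \<longrightarrow>
        (\<forall>t\<ge>0. t \<in> ex_ivl f D x \<and> N (flow f D t x - xs) \<le> \<epsilon>)) \<and>
     (\<forall>x\<in>S. {0..} \<subseteq> ex_ivl f D x \<and> ((\<lambda>t. N (flow f D t x - xs)) \<longlongrightarrow> 0) at_top)"

definition containment_times ::
  "(real^'n \<Rightarrow> real^'n) \<Rightarrow> (real^'n) set \<Rightarrow> (real^'n) set \<Rightarrow> real^'n \<Rightarrow> real \<Rightarrow> real set" where
  "containment_times f D S x \<tau> = {t\<in>{0<..\<tau>}. t \<in> ex_ivl f D x \<and> flow f D t x \<in> S}"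

definition eps_SRLF ::
  "(real^'n \<Rightarrow> real) \<Rightarrow> (real^'n \<Rightarrow> real^'n) \<Rightarrow> (real^'n) set \<Rightarrow> real^'n \<Rightarrow> (real^'n) set \<Rightarrow>
   real \<Rightarrow> real \<Rightarrow> (real^'n \<Rightarrow> real) \<Rightarrow> bool" where
  "eps_SRLF N f D xs S \<epsilon> \<tau> V \<longleftrightarrow>
     \<epsilon> > 0 \<and> nball N xs \<epsilon> \<subseteq> interior S \<and> \<tau> > 0 \<and>
     continuous_on D V \<and> (\<forall>x\<in>D. 0 \<le> V x) \<and>
     V xs = 0 \<and> (\<forall>x\<in>D - {xs}. 0 < V x) \<and>
     (\<forall>x\<in>closure (S - nball N xs \<epsilon>).
        \<exists>s\<in>containment_times f D S x \<tau>. V (flow f D s x) < V x)"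

end

theory Submission
  imports Defs
begin

text \<open>Every point of the compact set \<open>K = cl (S - B\<^sub>\<epsilon>)\<close> is carried by the flow into the open
  \<open>\<epsilon>\<close>-ball at some time. By continuous dependence on initial values (Gronwall), the same time works
  for all nearby points, so finitely many times suffice for \<open>K\<close>; \<open>\<tau>\<close> is the largest of them. On \<open>K\<close>
  the distance to the equilibrium is at least \<open>\<epsilon>\<close>, and the \<open>\<epsilon>\<close>-ball lies in \<open>S\<close>, so each of these
  times is a containment time at which \<open>V\<close> has decreased.\<close>

section \<open>Arbitrary norms versus the Euclidean norm\<close>

text \<open>Homogeneity and the triangle inequality make \<open>N\<close> convex, and a finite
  convex function on a finite-dimensional space is continuous.\<close>

lemma is_norm_continuous_on:
  fixes N :: "'a::euclidean_space \<Rightarrow> real"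
  assumes "is_norm N"
  shows "continuous_on A N"
proof -
  have "convex_on UNIV N"
  proof (rule convex_onI)
    fix t :: real and x y :: 'a
    assume "0 < t" "t < 1"
    then have "N ((1 - t) *\<^sub>R x) = (1 - t) * N x" "N (t *\<^sub>R y) = t * N y"
      using assms unfolding is_norm_def by auto
    then show "N ((1 - t) *\<^sub>R x + t *\<^sub>R y) \<le> (1 - t) * N x + t * N y"
      using assms unfolding is_norm_def by metis
  qed simp
  then have "continuous_on UNIV N"
    using convex_on_continuous open_UNIV by blast
  then show ?thesis
    using continuous_on_subset by blast
qed

text \<open>The constants are the extrema of \<open>N\<close> on the Euclidean unit sphere, attained
  by compactness. They are positive because \<open>N\<close> vanishes only at \<open>0\<close>;
  homogeneity extends the bounds to all vectors.\<close>

lemma is_norm_equivalent: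
  fixes N :: "'a::euclidean_space \<Rightarrow> real"
  assumes N: "is_norm N"
  obtains a b where "a > 0" "b > 0" "\<And>x. a * norm x \<le> N x" "\<And>x. N x \<le> b * norm x"
proof -
  have ne: "sphere (0::'a) 1 \<noteq> {}" by simp
  obtain p where p: "p \<in> sphere 0 1" "\<And>x. x \<in> sphere 0 1 \<Longrightarrow> N p \<le> N x"
    using continuous_attains_inf[OF compact_sphere ne is_norm_continuous_on[OF N]] by blast
  obtain q where q: "q \<in> sphere 0 1" "\<And>x. x \<in> sphere 0 1 \<Longrightarrow> N x \<le> N q"
    using continuous_attains_sup[OF compact_sphere ne is_norm_continuous_on[OF N]] by blast
  have pos: "N z > 0" if "z \<in> sphere 0 1" for z
  proof -
    have "z \<noteq> 0" using that by auto
    then show ?thesis using N unfolding is_norm_def by (metis less_le)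
  qed
  have "N p * norm x \<le> N x \<and> N x \<le> N q * norm x" for x
  proof (cases "x = 0")
    case True
    moreover have "N 0 = 0" using N unfolding is_norm_def by blast
    ultimately show ?thesis by simp
  next
    case False
    define z where "z = x /\<^sub>R norm x"
    have z: "z \<in> sphere 0 1" using False by (simp add: z_def)
    have "N (norm x *\<^sub>R z) = \<bar>norm x\<bar> * N z"
      using N unfolding is_norm_def by blast
    moreover have "norm x *\<^sub>R z = x" using False by (simp add: z_def)
    ultimately have "N x = N z * norm x" by simp
    then show ?thesis using p(2)[OF z] q(2)[OF z] by (simp add: mult_right_mono)
  qed
  then show ?thesis using that pos[OF p(1)] pos[OF q(1)] by blast
qed

text \<open>Passes to the Euclidean norm, whose inner product the Gronwall argument differentiates.
  Norm equivalence costs a factor \<open>b / a\<close> in the constant.\<close>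

lemma locally_lipschitz_norm:
  assumes N: "is_norm N" and f: "locally_lipschitz N D f" and K: "compact K" "K \<subseteq> D"
  obtains L where "L \<ge> 0" "\<And>x y. x \<in> K \<Longrightarrow> y \<in> K \<Longrightarrow> norm (f x - f y) \<le> L * norm (x - y)"
proof -
  have "\<exists>M\<ge>0. \<forall>x\<in>K. \<forall>y\<in>K. N (f y - f x) \<le> M * N (y - x)"
    using f K unfolding locally_lipschitz_def by simp
  then obtain M where M: "M \<ge> 0" "\<And>x y. x \<in> K \<Longrightarrow> y \<in> K \<Longrightarrow> N (f y - f x) \<le> M * N (y - x)"
    by blast
  obtain a b where ab: "a > 0" "b > 0" "\<And>x. a * norm x \<le> N x" "\<And>x. N x \<le> b * norm x"
    by (rule is_norm_equivalent[OF N]) (rule that)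
  have "norm (f x - f y) \<le> (M * b / a) * norm (x - y)" if "x \<in> K" "y \<in> K" for x y
  proof -
    have "a * norm (f x - f y) \<le> M * N (x - y)"
      using ab(3)[of "f x - f y"] M(2)[OF that(2,1)] by linarith
    also have "\<dots> \<le> M * (b * norm (x - y))"
      using ab(4) M(1) by (intro mult_left_mono)
    finally show ?thesis using ab(1) by (simp add: field_simps)
  qed
  then show ?thesis using that[of "M * b / a"] M(1) ab(1,2) by simp
qed

section \<open>Gronwall's estimate\<close>

text \<open>Gronwall's estimate. The Lipschitz bound is only required at interior times, so that it
  applies up to the first time at which the solutions might leave a region.\<close>

lemma solution_difference_bound:
  fixes u v :: "real \<Rightarrow> 'a::real_inner"
  assumes T: "0 \<le> T"
    and u: "\<And>t. t \<in> {0..T} \<Longrightarrow> (u has_vector_derivative f (u t)) (at t)"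
    and v: "\<And>t. t \<in> {0..T} \<Longrightarrow> (v has_vector_derivative f (v t)) (at t)"
    and L: "\<And>t. t \<in> {0<..<T} \<Longrightarrow> norm (f (u t) - f (v t)) \<le> L * norm (u t - v t)"
  shows "norm (u T - v T) \<le> norm (u 0 - v 0) * exp (L * T)"
proof -
  \<comment> \<open>The squared distance is differentiable even where the solutions meet, unlike the
    distance itself. The exponential factor absorbs the growth rate \<open>2 * L\<close>, so that
    \<open>w\<close> is nonincreasing.\<close>
  define w where "w = (\<lambda>t. (u t - v t) \<bullet> (u t - v t) * exp (- (2 * L * t)))"
  have deriv: "(w has_real_derivative
      (2 * ((u t - v t) \<bullet> (f (u t) - f (v t))) - 2 * L * ((u t - v t) \<bullet> (u t - v t)))
        * exp (- (2 * L * t))) (at t)"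
    if "t \<in> {0..T}" for t
  proof -
    have d: "((\<lambda>t. u t - v t) has_derivative (\<lambda>h. h *\<^sub>R (f (u t) - f (v t)))) (at t)"
      using has_vector_derivative_diff[OF u[OF that] v[OF that]]
      by (simp add: has_vector_derivative_def)
    have "((\<lambda>t. (u t - v t) \<bullet> (u t - v t)) has_derivative
        (\<lambda>h. 2 * ((u t - v t) \<bullet> (f (u t) - f (v t))) * h)) (at t)"
      by (rule has_derivative_eq_rhs[OF has_derivative_inner[OF d d]])
        (simp add: fun_eq_iff inner_commute)
    then have "((\<lambda>t. (u t - v t) \<bullet> (u t - v t)) has_real_derivative
        2 * ((u t - v t) \<bullet> (f (u t) - f (v t)))) (at t)"
      by (simp add: has_field_derivative_def)
    moreover have "((\<lambda>t. exp (- (2 * L * t))) has_real_derivative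
        - (2 * L) * exp (- (2 * L * t))) (at t)"
      by (auto intro!: derivative_eq_intros)
    ultimately show ?thesis
      unfolding w_def by (rule DERIV_cong[OF DERIV_mult]) (simp add: left_diff_distrib)
  qed
  have "w T \<le> w 0"
  \<comment> \<open>The sign of the derivative is checked only at interior times; continuity covers
    the endpoints. Cauchy-Schwarz and the Lipschitz bound give the sign.\<close>
  proof (rule DERIV_nonpos_imp_decreasing_open[OF T])
    fix t assume t: "0 < t" "t < T"
    have "(u t - v t) \<bullet> (f (u t) - f (v t)) \<le> norm (u t - v t) * norm (f (u t) - f (v t))"
      by (rule norm_cauchy_schwarz)
    also have "\<dots> \<le> norm (u t - v t) * (L * norm (u t - v t))"
      using L t by (intro mult_left_mono) auto
    also have "\<dots> = L * ((u t - v t) \<bullet> (u t - v t))"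
      by (simp add: dot_square_norm power2_eq_square)
    finally have "(2 * ((u t - v t) \<bullet> (f (u t) - f (v t)))
        - 2 * L * ((u t - v t) \<bullet> (u t - v t))) * exp (- (2 * L * t)) \<le> 0"
      by (intro mult_nonpos_nonneg) auto
    then show "\<exists>y. (w has_real_derivative y) (at t) \<and> y \<le> 0"
      using deriv[of t] t by auto
  next
    show "continuous_on {0..T} w"
      using deriv by (intro continuous_at_imp_continuous_on ballI) (blast intro: DERIV_isCont)
  qed
  then have "(norm (u T - v T))\<^sup>2 * exp (- (2 * L * T)) \<le> (norm (u 0 - v 0))\<^sup>2"
    by (simp add: w_def dot_square_norm)
  then have "(norm (u T - v T))\<^sup>2 \<le> (norm (u 0 - v 0))\<^sup>2 * exp (2 * L * T)"
    by (simp add: exp_minus field_simps)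
  also have "\<dots> = (norm (u 0 - v 0) * exp (L * T))\<^sup>2"
    by (simp add: power_mult_distrib exp_double[symmetric] mult.assoc)
  finally show ?thesis
    by (rule power2_le_imp_le) simp
qed

section \<open>Uniqueness and continuous dependence of solutions\<close>

lemma solution_on_D:
  assumes "solution_on f D x J u" "T \<in> J" "t \<in> {0..T}"
  shows "u t \<in> D" "(u has_vector_derivative f (u t)) (at t)"
proof -
  have "t \<in> J"
    using assms unfolding solution_on_def by (metis atLeastAtMost_iff is_interval_1)
  then show "u t \<in> D" "(u has_vector_derivative f (u t)) (at t)"
    using assms(1) unfolding solution_on_def by auto
qed

lemma solution_on_continuous_on:
  assumes "solution_on f D x J u" "T \<in> J"
  shows "continuous_on {0..T} u"
  using solution_on_D(2)[OF assms]
  by (intro continuous_at_imp_continuous_on ballI has_vector_derivative_continuous) auto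

text \<open>Both trajectories up to time \<open>t\<close> form a compact subset of \<open>D\<close>,
  which supplies a Lipschitz constant; Gronwall with zero initial distance then forces
  equality.\<close>

lemma solution_on_unique:
  assumes N: "is_norm N" and f: "locally_lipschitz N D f"
    and u: "solution_on f D x J u" "t \<in> J" and v: "solution_on f D x J' v" "t \<in> J'"
    and t: "0 \<le> t"
  shows "u t = v t"
proof -
  let ?K = "u ` {0..t} \<union> v ` {0..t}"
  have "compact ?K"
    using solution_on_continuous_on[OF u] solution_on_continuous_on[OF v]
    by (intro compact_Un compact_continuous_image) auto
  moreover have "?K \<subseteq> D"
    using solution_on_D(1)[OF u] solution_on_D(1)[OF v] by auto
  ultimately obtain L where
    L: "\<And>y z. y \<in> ?K \<Longrightarrow> z \<in> ?K \<Longrightarrow> norm (f y - f z) \<le> L * norm (y - z)"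
    using locally_lipschitz_norm[OF N f] by metis
  have "norm (u t - v t) \<le> norm (u 0 - v 0) * exp (L * t)"
    by (rule solution_difference_bound[OF t solution_on_D(2)[OF u] solution_on_D(2)[OF v]])
      (auto intro!: L)
  moreover have "u 0 = v 0" using u v unfolding solution_on_def by auto
  ultimately show ?thesis by simp
qed

text \<open>Uniqueness makes the definite description in \<open>flow\<close> meaningful, so any
  solution reaching \<open>t\<close> may be used to compute it.\<close>

lemma flow_eq_solution:
  assumes "is_norm N" "locally_lipschitz N D f" "solution_on f D x J u" "t \<in> J" "0 \<le> t"
  shows "flow f D t x = u t"
  unfolding flow_def
proof (rule the_equality)
  show "\<exists>J' v. solution_on f D x J' v \<and> t \<in> J' \<and> v t = u t"
    using assms by blast
next
  fix y assume "\<exists>J' v. solution_on f D x J' v \<and> t \<in> J' \<and> v t = y"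
  then show "y = u t"
    using solution_on_unique[OF assms(1,2) _ _ assms(3,4,5)] by blast
qed

text \<open>Gronwall is applied in a compact tube around the reference trajectory, which a nearby
  solution cannot leave before \<open>T\<close>. That the nearby solution exists up to
  \<open>T\<close> is assumed here; in the application it comes from asymptotic stability on
  \<open>S\<close>.\<close>

lemma solution_on_continuous_dependence:
  assumes N: "is_norm N" and D: "open D" and f: "locally_lipschitz N D f"
    and u: "solution_on f D x J u" "T \<in> J" and T: "0 \<le> T" and \<eta>: "\<eta> > 0"
  obtains \<delta> where "\<delta> > 0"
    "\<And>y J' v. solution_on f D y J' v \<Longrightarrow> T \<in> J' \<Longrightarrow> norm (y - x) < \<delta> \<Longrightarrow> norm (v T - u T) < \<eta>"
proof -
  let ?C = "u ` {0..T}"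
  have C: "compact ?C" "?C \<subseteq> D"
    using solution_on_continuous_on[OF u] solution_on_D(1)[OF u]
    by (auto intro!: compact_continuous_image)
  obtain e where e: "e > 0" "(\<Union>c\<in>?C. ball c e) \<subseteq> D"
    using compact_subset_open_imp_ball_epsilon_subset[OF C(1) D C(2)] by blast
  \<comment> \<open>Tube radius: \<open>r < e\<close> keeps the closed tube \<open>K\<close> inside
    \<open>D\<close>, and \<open>r \<le> \<eta>\<close> makes staying in the tube enough for the
    claim.\<close>
  define r where "r = min (e / 2) \<eta>"
  have r: "0 < r" "r < e" "r \<le> \<eta>" using e(1) \<eta> by (auto simp: r_def)
  define K where "K = (\<Union>c\<in>?C. cball c r)"
  have K: "compact K" unfolding K_def by (rule compact_minkowski_sum_cball[OF C(1)])
  have in_K: "z \<in> K" if "t \<in> {0..T}" "norm (z - u t) \<le> r" for z t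
    using that unfolding K_def by (auto simp: dist_norm norm_minus_commute)
  have "K \<subseteq> (\<Union>c\<in>?C. ball c e)" unfolding K_def using r(2) by force
  then have "K \<subseteq> D" using e(2) by blast
  then obtain L where L: "L \<ge> 0"
    "\<And>y z. y \<in> K \<Longrightarrow> z \<in> K \<Longrightarrow> norm (f y - f z) \<le> L * norm (y - z)"
    using locally_lipschitz_norm[OF N f K] by metis
  \<comment> \<open>The initial radius \<open>r * exp (- (L * T))\<close> is chosen so that the
    Gronwall bound stays below \<open>r\<close> at every time up to \<open>T\<close>.\<close>
  have "norm (v T - u T) < \<eta>"
    if v: "solution_on f D y J' v" "T \<in> J'" and y: "norm (y - x) < r * exp (- (L * T))" for y J' v
  proof -
    have init: "norm (v 0 - u 0) = norm (y - x)"
      using u v unfolding solution_on_def by auto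
    have small: "norm (y - x) * exp (L * t) < r" if "t \<le> T" for t
    proof -
      have "norm (y - x) * exp (L * t) \<le> norm (y - x) * exp (L * T)"
        using that L(1) by (intro mult_left_mono) (auto intro: mult_left_mono)
      also have "\<dots> < r" using y by (simp add: exp_minus field_simps)
      finally show ?thesis .
    qed
    \<comment> \<open>\<open>E\<close> collects the times at which the tube boundary is reached or
      passed. It is closed, so if nonempty it contains a first such time \<open>Inf E\<close>.
      Before that time both solutions lie in \<open>K\<close>, so Gronwall puts their distance at
      \<open>Inf E\<close> strictly below \<open>r\<close>, a contradiction.\<close>
    define E where "E = {t \<in> {0..T}. r \<le> norm (v t - u t)}"
    have "E = {}"
    proof (rule ccontr)
      assume ne: "E \<noteq> {}"
      have "continuous_on {0..T} (\<lambda>t. norm (v t - u t))"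
        by (intro continuous_intros solution_on_continuous_on[OF u] solution_on_continuous_on[OF v])
      then have "closed E"
        unfolding E_def by (intro continuous_on_closed_Collect_le continuous_on_const closed_atLeastAtMost)
      moreover have "bdd_below E" unfolding E_def by (rule bdd_belowI[of _ 0]) auto
      ultimately have s: "Inf E \<in> E" and before: "\<And>t. t < Inf E \<Longrightarrow> t \<notin> E"
        using closed_contains_Inf[OF ne] by (auto dest: cInf_lower)
      let ?s = "Inf E"
      have sT: "0 \<le> ?s" "?s \<le> T" using s unfolding E_def by auto
      have "norm (v ?s - u ?s) \<le> norm (v 0 - u 0) * exp (L * ?s)"
      proof (rule solution_difference_bound[OF sT(1)])
        fix t assume t: "t \<in> {0<..<?s}"
        then have "norm (v t - u t) \<le> r" "t \<in> {0..T}"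
          using before[of t] sT(2) unfolding E_def by auto
        then have "v t \<in> K" "u t \<in> K"
          using in_K[of t "v t"] in_K[of t "u t"] r(1) by auto
        then show "norm (f (v t) - f (u t)) \<le> L * norm (v t - u t)" by (rule L(2))
      qed (use sT solution_on_D(2)[OF u] solution_on_D(2)[OF v] in auto)
      then have "norm (v ?s - u ?s) < r" using small[OF sT(2)] init by simp
      then show False using s unfolding E_def by auto
    qed
    then have "norm (v T - u T) < r" using T unfolding E_def by auto
    then show ?thesis using r(3) by simp
  qed
  then show ?thesis using that[of "r * exp (- (L * T))"] r(1) by auto
qed

section \<open>A uniform time by compactness\<close>

theorem theorem4:
  fixes D S :: "(real^'n) set" and f :: "real^'n \<Rightarrow> real^'n"
    and xs :: "real^'n" and N :: "real^'n \<Rightarrow> real"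
  assumes "is_norm N"
    and "open D"
    and "locally_lipschitz N D f"
    and "equilibrium f D xs"
    and "compact S" and "S \<subseteq> D" and "xs \<in> interior S"
    and "asymptotically_stable_on N f D xs S"
  shows "\<forall>\<epsilon>>0. nball N xs \<epsilon> \<subseteq> interior S \<longrightarrow>
           (\<exists>\<tau>>0. eps_SRLF N f D xs S \<epsilon> \<tau> (\<lambda>x. N (x - xs)))"
proof (intro allI impI)
  fix \<epsilon> :: real
  assume \<epsilon>: "\<epsilon> > 0" and ball: "nball N xs \<epsilon> \<subseteq> interior S"
  note N = assms(1) and f = assms(3)
  let ?K = "closure (S - nball N xs \<epsilon>)"
  let ?V = "\<lambda>x. N (x - xs)"
  have contV: "continuous_on A ?V" for A
  proof -
    have "continuous_on A (N \<circ> (\<lambda>x. x - xs))"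
      by (intro continuous_on_compose is_norm_continuous_on[OF N] continuous_intros)
    then show ?thesis by (simp add: o_def)
  qed
  have KS: "?K \<subseteq> S"
    using compact_imp_closed[OF assms(5)] by (intro closure_minimal) auto
  then have K: "compact ?K"
    using assms(5) by (metis closed_closure compact_Int_closed inf.absorb2)
  \<comment> \<open>Taking the closure weakens the strict inequality outside the ball to
    \<open>\<epsilon> \<le> ?V x\<close>. This suffices because the flow is later brought strictly
    below \<open>\<epsilon>\<close>.\<close>
  have "closed {x. \<epsilon> \<le> ?V x}"
    by (intro closed_Collect_le contV continuous_on_const)
  then have "?K \<subseteq> {x. \<epsilon> \<le> ?V x}"
    unfolding nball_def by (intro closure_minimal) auto
  then have KV: "\<epsilon> \<le> ?V x" if "x \<in> ?K" for x
    using that by blast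
  have sol: "\<exists>J u. solution_on f D x J u \<and> t \<in> J" if "x \<in> S" "0 \<le> t" for x t
  proof -
    have "{0..} \<subseteq> ex_ivl f D x"
      using assms(8) that(1) unfolding asymptotically_stable_on_def by blast
    then have "t \<in> ex_ivl f D x" using that(2) by auto
    then show ?thesis unfolding ex_ivl_def by blast
  qed
  \<comment> \<open>One time serves a whole neighbourhood of \<open>x\<close> relative to
    \<open>S\<close>; points of \<open>S\<close> have solutions for all nonnegative times.\<close>
  have "\<exists>t \<delta>. t > 0 \<and> \<delta> > 0 \<and> (\<forall>y\<in>S. norm (y - x) < \<delta> \<longrightarrow> ?V (flow f D t y) < \<epsilon>)"
    if x: "x \<in> S" for x
  proof -
    have "((\<lambda>t. ?V (flow f D t x)) \<longlongrightarrow> 0) at_top"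
      using assms(8) x unfolding asymptotically_stable_on_def by blast
    \<comment> \<open>Positivity of \<open>t\<close> is requested along with smallness because
      containment times exclude \<open>0\<close>.\<close>
    then have "\<forall>\<^sub>F t in at_top. ?V (flow f D t x) < \<epsilon> \<and> 0 < t"
      using \<epsilon> by (intro eventually_conj order_tendstoD(2) eventually_gt_at_top)
    then obtain t where t: "?V (flow f D t x) < \<epsilon>" "0 < t"
      using eventually_happens' trivial_limit_at_top_linorder by blast
    obtain J u where u: "solution_on f D x J u" "t \<in> J" using sol[OF x, of t] t(2) by auto
    have ut: "?V (u t) < \<epsilon>" using flow_eq_solution[OF N f u] t by simp
    have "open {z. ?V z < \<epsilon>}" by (intro open_Collect_less contV continuous_on_const)
    then obtain \<eta> where \<eta>: "\<eta> > 0" "\<And>z. norm (z - u t) < \<eta> \<Longrightarrow> ?V z < \<epsilon>"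
      using ut unfolding open_dist dist_norm by blast
    obtain \<delta> where \<delta>: "\<delta> > 0"
      "\<And>y J' v. solution_on f D y J' v \<Longrightarrow> t \<in> J' \<Longrightarrow> norm (y - x) < \<delta> \<Longrightarrow> norm (v t - u t) < \<eta>"
      using solution_on_continuous_dependence[OF N assms(2) f u _ \<eta>(1)] t(2)
      by (metis less_imp_le)
    have "?V (flow f D t y) < \<epsilon>" if y: "y \<in> S" "norm (y - x) < \<delta>" for y
    proof -
      obtain J' v where v: "solution_on f D y J' v" "t \<in> J'" using sol[OF y(1), of t] t(2) by auto
      show ?thesis
        using flow_eq_solution[OF N f v] \<delta>(2)[OF v y(2)] \<eta>(2) t(2) by simp
    qed
    then show ?thesis using t(2) \<delta>(1) by blast
  qed
  then obtain t \<delta> where t: "\<And>x. x \<in> S \<Longrightarrow> t x > (0::real)" and \<delta>: "\<And>x. x \<in> S \<Longrightarrow> \<delta> x > (0::real)"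
    and near: "\<And>x y. x \<in> S \<Longrightarrow> y \<in> S \<Longrightarrow> norm (y - x) < \<delta> x \<Longrightarrow> ?V (flow f D (t x) y) < \<epsilon>"
    by metis
  have "?K \<subseteq> (\<Union>x\<in>?K. ball x (\<delta> x))"
    using \<delta> KS by force
  then obtain F where F: "F \<subseteq> ?K" "finite F" "?K \<subseteq> (\<Union>x\<in>F. ball x (\<delta> x))"
    using compactE_image[OF K, of ?K "\<lambda>x. ball x (\<delta> x)"] by auto
  \<comment> \<open>Inserting \<open>1\<close> keeps the maximum defined and positive when
    \<open>F\<close> is empty, as can happen if \<open>?K\<close> is empty.\<close>
  define \<tau> where "\<tau> = Max (insert 1 (t ` F))"
  have \<tau>: "\<tau> > 0" "\<And>x. x \<in> F \<Longrightarrow> t x \<le> \<tau>"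
    using F(2) by (auto simp: \<tau>_def Max_gr_iff)
  have "\<exists>s\<in>containment_times f D S x \<tau>. ?V (flow f D s x) < ?V x" if x: "x \<in> ?K" for x
  proof -
    obtain c where c: "c \<in> F" "norm (x - c) < \<delta> c"
      using F(3) x by (auto simp: dist_norm norm_minus_commute)
    have S: "c \<in> S" "x \<in> S" using c(1) F(1) KS x by auto
    have small: "?V (flow f D (t c) x) < \<epsilon>" using near S c(2) by blast
    then have "flow f D (t c) x \<in> nball N xs \<epsilon>" unfolding nball_def by simp
    then have "flow f D (t c) x \<in> S" using ball interior_subset by blast
    moreover have "t c \<in> ex_ivl f D x"
      using sol[OF S(2), of "t c"] t[OF S(1)] unfolding ex_ivl_def by auto
    ultimately have "t c \<in> containment_times f D S x \<tau>"
      using t[OF S(1)] \<tau>(2)[OF c(1)] unfolding containment_times_def by auto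
    \<comment> \<open>The chain is
      \<open>?V (flow f D (t c) x) < \<epsilon> \<le> ?V x\<close>.\<close>
    then show ?thesis using small KV[OF x] by force
  qed
  moreover have "N 0 = 0"
    using N unfolding is_norm_def by blast
  moreover have "0 \<le> ?V x" "?V x = 0 \<longleftrightarrow> x = xs" for x
    using N unfolding is_norm_def by auto
  ultimately have "eps_SRLF N f D xs S \<epsilon> \<tau> ?V"
    unfolding eps_SRLF_def using \<epsilon> ball \<tau>(1) contV by (auto simp: less_le)
  then show "\<exists>\<tau>>0. eps_SRLF N f D xs S \<epsilon> \<tau> ?V" using \<tau>(1) by blast
qed

end
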